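(* Define sequences of integers $a_n, b_n, c_n$ ($n \geq 0$) by the generating functions $$\sum_{n \geq 0} a_n t^n = \frac{293155\,t^2+888826\,t-29}{(1-t)(t^2-103682\,t+1)},$$ $$\sum_{n \geq 0} b_n t^n = -\frac{237169\,t^2+550798\,t+1}{(1-t)(t^2-103682\,t+1)},$$ $$\sum_{n \geq 0} c_n t^n = \frac{90601\,t^2-878594\,t+25}{(1-t)(t^2-103682\,t+1)}.$$ Then for all $n \geq 0$, $$a_n^3 + 2\, b_n^3 + 2\, c_n^3 = 6859.$$
   Context: The generating functions are understood as formal power series in $t$ (the Taylor expansions at $t=0$ of the given rational functions). *)

theory Defs
  imports "HOL-Computational_Algebra.Formal_Power_Series"
begin

(* Division in rat fps is multiplication by the power series inverse here, since the
   denominator has constant coefficient 1. *)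

definition gf_denom :: "rat fps" where
  "gf_denom = (1 - fps_X) * (fps_X ^ 2 - 103682 * fps_X + 1)"

end

theory Submission
  imports Defs
begin

text \<open>
  The affine cubic surface \<open>x\<^sup>3 + 2 y\<^sup>3 + 2 z\<^sup>3 = 19\<^sup>3\<close> contains the line \<open>x = 19, y + z = 0\<close>.
  The points \<open>(a\<^sub>n, b\<^sub>n, c\<^sub>n)\<close> all lie in one plane through this line, \<open>x = 19 - 2 (y + z)\<close>.
  That plane meets the surface in the line and a residual conic, which is
  \<open>y\<^sup>2 + 3 y z + z\<^sup>2 - 38 (y + z) + 361 = 0\<close> in the coordinates \<open>(y, z)\<close>.

  Centred at \<open>(38/5, 38/5)\<close> the conic has the quadratic part \<open>u\<^sup>2 + 3 u v + v\<^sup>2\<close>, the norm of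
  \<open>u + v \<epsilon>\<close> in the ring of integers of \<open>\<rat>(\<surd>5)\<close>, where \<open>\<epsilon> = (3 + \<surd>5)/2\<close>. Multiplication by a unit
  of norm 1 therefore maps the conic to itself. The number 103682 is the trace of \<open>\<epsilon>\<^sup>1\<^sup>2\<close>, and
  passing from \<open>(b\<^sub>n, c\<^sub>n)\<close> to \<open>(b\<^sub>n\<^sub>+\<^sub>1, c\<^sub>n\<^sub>+\<^sub>1)\<close> is multiplication by \<open>\<epsilon>\<^sup>1\<^sup>2\<close> about the centre.
  This is an affine map with integer coefficients, so integrality and the equation of the conic
  both propagate by induction from the point \<open>(-1, 25)\<close>
  (\<open>unit_orbit_integral_on_conic\<close>). The generating functions serve only to establish the plane and this
  first-order recurrence (\<open>generating_function_steps\<close>).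
\<close>

text \<open>
  On the plane \<open>x - 19 = -2 (y + z)\<close> the difference of cubes and the sum of cubes share the factor
  \<open>y + z\<close>; what remains is \<open>y\<^sup>2 - y z + z\<^sup>2 - (x\<^sup>2 + 19 x + 361)\<close>, which on the plane is \<open>-3\<close> times
  the conic.
\<close>

lemma cubic_surface_contains_conic:
  fixes x y z :: "'a :: comm_ring_1"
  assumes plane: "x = 19 - 2 * (y + z)"
    and conic: "y^2 + 3 * y * z + z^2 - 38 * (y + z) + 361 = 0"
  shows "x^3 + 2 * y^3 + 2 * z^3 = 6859"
proof -
  have "x^3 + 2 * y^3 + 2 * z^3 - 6859
      = - (6 * (y + z)) * (y^2 + 3 * y * z + z^2 - 38 * (y + z) + 361)"
    unfolding plane by (simp add: algebra_simps power2_eq_square power3_eq_cube)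
  then have "x^3 + 2 * y^3 + 2 * z^3 - 6859 = 0"
    unfolding conic by simp
  then show ?thesis
    by simp
qed

text \<open>
  In centred coordinates the step is \<open>u + v \<epsilon> \<mapsto> \<epsilon>\<^sup>1\<^sup>2 (u + v \<epsilon>)\<close>. Since \<open>\<epsilon>\<^sup>2 = 3 \<epsilon> - 1\<close>, the powers
  of \<open>\<epsilon>\<close> have Fibonacci coefficients, \<open>\<epsilon>\<^sup>1\<^sup>2 = F\<^sub>2\<^sub>4 \<epsilon> - F\<^sub>2\<^sub>2\<close>, whence the matrix entries
  \<open>F\<^sub>2\<^sub>2 = 17711\<close>, \<open>F\<^sub>2\<^sub>4 = 46368\<close> and \<open>F\<^sub>2\<^sub>6 = 121393\<close>. The constant terms fix the centre
  \<open>(38/5, 38/5)\<close>. The norm is preserved because \<open>F\<^sub>2\<^sub>4\<^sup>2 - F\<^sub>2\<^sub>2 F\<^sub>2\<^sub>6 = 1\<close>.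
\<close>

lemma unit_step_preserves_conic:
  fixes y z :: "'a :: comm_ring_1"
  assumes "y^2 + 3 * y * z + z^2 - 38 * (y + z) + 361 = 0"
    and "y' = - 17711 * y - 46368 * z + 487008"
    and "z' = 46368 * y + 121393 * z - 1274976"
  shows "y'^2 + 3 * y' * z' + z'^2 - 38 * (y' + z') + 361 = 0"
proof -
  have "y'^2 + 3 * y' * z' + z'^2 - 38 * (y' + z') + 361
      = y^2 + 3 * y * z + z^2 - 38 * (y + z) + 361"
    unfolding assms(2,3) by (simp add: algebra_simps power2_eq_square)
  then show ?thesis
    using assms(1) by simp
qed

lemma unit_orbit_integral_on_conic:
  fixes b c :: "nat \<Rightarrow> rat"
  assumes "b 0 = - 1" "c 0 = 25"
    and "\<And>n. b (Suc n) = - 17711 * b n - 46368 * c n + 487008"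
    and "\<And>n. c (Suc n) = 46368 * b n + 121393 * c n - 1274976"
  shows "b n \<in> \<int> \<and> c n \<in> \<int> \<and>
    b n ^ 2 + 3 * b n * c n + c n ^ 2 - 38 * (b n + c n) + 361 = 0"
proof (induction n)
  case 0
  show ?case
    by (simp add: assms(1,2))
next
  case (Suc n)
  then have "b (Suc n) \<in> \<int>" "c (Suc n) \<in> \<int>"
    by (simp_all add: assms(3,4))
  moreover from Suc.IH have
    "b (Suc n) ^ 2 + 3 * b (Suc n) * c (Suc n) + c (Suc n) ^ 2
      - 38 * (b (Suc n) + c (Suc n)) + 361 = 0"
    by (intro unit_step_preserves_conic[OF _ assms(3,4)]) simp
  ultimately show ?case
    by blast
qed

lemma gf_denom_nth_0: "fps_nth gf_denom 0 = 1"
  by (simp add: gf_denom_def)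

lemma divide_gf_denom_mult: "f / gf_denom * gf_denom = f"
  using fps_divide_unit[of gf_denom f] inverse_mult_eq_1[of gf_denom]
  by (simp add: gf_denom_nth_0 mult.assoc)

lemma gf_denom_mult_cancel: "f * gf_denom = g * gf_denom \<Longrightarrow> f = g"
  using gf_denom_nth_0 by auto

text \<open>
  A constant term in a recurrence becomes a multiple of the geometric series \<open>1 / (1 - t)\<close>, so each
  claim is an equation between power series. Since \<open>1 - t\<close> divides the denominator, multiplying
  by the denominator turns each of these equations into a polynomial identity.
\<close>

lemma generating_function_steps:
  fixes a b c :: "nat \<Rightarrow> rat"
  assumes a: "Abs_fps a = (293155 * fps_X ^ 2 + 888826 * fps_X - 29) / gf_denom"
    and b: "Abs_fps b = - ((237169 * fps_X ^ 2 + 550798 * fps_X + 1) / gf_denom)"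
    and c: "Abs_fps c = (90601 * fps_X ^ 2 - 878594 * fps_X + 25) / gf_denom"
  shows "a n = 19 - 2 * (b n + c n)"
    and "b 0 = - 1" and "c 0 = 25"
    and "b (Suc n) = - 17711 * b n - 46368 * c n + 487008"
    and "c (Suc n) = 46368 * b n + 121393 * c n - 1274976"
proof -
  define A B C where "A = Abs_fps a" and "B = Abs_fps b" and "C = Abs_fps c"
  define G :: "rat fps" where "G = Abs_fps (\<lambda>_. 1)"
  let ?X = "fps_X :: rat fps"
  have A: "A * gf_denom = 293155 * ?X ^ 2 + 888826 * ?X - 29"
    by (simp add: A_def a divide_gf_denom_mult)
  have B: "B * gf_denom = - (237169 * ?X ^ 2 + 550798 * ?X + 1)"
    by (simp add: B_def b divide_gf_denom_mult)
  have C: "C * gf_denom = 90601 * ?X ^ 2 - 878594 * ?X + 25"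
    by (simp add: C_def c divide_gf_denom_mult)
  have "G * (1 - ?X) = 1"
    by (rule fps_ext) (simp add: G_def algebra_simps)
  then have G: "G * gf_denom = ?X ^ 2 - 103682 * ?X + 1"
    unfolding gf_denom_def by (metis mult.assoc mult_1)
  have coeffs: "fps_nth A k = a k" "fps_nth B k = b k" "fps_nth C k = c k" "fps_nth G k = 1" for k
    by (simp_all add: A_def B_def C_def G_def)

  have plane: "A = 19 * G - 2 * (B + C)"
  proof (rule gf_denom_mult_cancel)
    have "(19 * G - 2 * (B + C)) * gf_denom
        = 19 * (G * gf_denom) - 2 * (B * gf_denom + C * gf_denom)"
      by (simp only: algebra_simps)
    then show "A * gf_denom = (19 * G - 2 * (B + C)) * gf_denom"
      unfolding A B C G by (simp add: algebra_simps)
  qed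
  have step_b: "B = - 1 + ?X * (- 17711 * B - 46368 * C + 487008 * G)"
  proof (rule gf_denom_mult_cancel)
    have "(- 1 + ?X * (- 17711 * B - 46368 * C + 487008 * G)) * gf_denom
        = - gf_denom + ?X * (- 17711 * (B * gf_denom) - 46368 * (C * gf_denom)
            + 487008 * (G * gf_denom))"
      by (simp add: algebra_simps)
    then show "B * gf_denom = (- 1 + ?X * (- 17711 * B - 46368 * C + 487008 * G)) * gf_denom"
      unfolding B C G by (simp add: gf_denom_def algebra_simps power2_eq_square)
  qed
  have step_c: "C = 25 + ?X * (46368 * B + 121393 * C - 1274976 * G)"
  proof (rule gf_denom_mult_cancel)
    have "(25 + ?X * (46368 * B + 121393 * C - 1274976 * G)) * gf_denom
        = 25 * gf_denom + ?X * (46368 * (B * gf_denom) + 121393 * (C * gf_denom)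
            - 1274976 * (G * gf_denom))"
      by (simp add: algebra_simps)
    then show "C * gf_denom = (25 + ?X * (46368 * B + 121393 * C - 1274976 * G)) * gf_denom"
      unfolding B C G by (simp add: gf_denom_def algebra_simps power2_eq_square)
  qed

  show "a n = 19 - 2 * (b n + c n)"
    using arg_cong[OF plane, of "\<lambda>f. fps_nth f n"]
    by (simp add: coeffs numeral_fps_const)
  show "b 0 = - 1"
    using arg_cong[OF step_b, of "\<lambda>f. fps_nth f 0"] by (simp add: coeffs)
  show "c 0 = 25"
    using arg_cong[OF step_c, of "\<lambda>f. fps_nth f 0"] by (simp add: coeffs)
  show "b (Suc n) = - 17711 * b n - 46368 * c n + 487008"
    using arg_cong[OF step_b, of "\<lambda>f. fps_nth f (Suc n)"]
    by (simp add: coeffs numeral_fps_const fps_const_neg[symmetric] del: fps_const_neg)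
  show "c (Suc n) = 46368 * b n + 121393 * c n - 1274976"
    using arg_cong[OF step_c, of "\<lambda>f. fps_nth f (Suc n)"]
    by (simp add: coeffs numeral_fps_const)
qed

theorem mainTheorem1:
  fixes a b c :: "nat \<Rightarrow> rat"
  assumes "Abs_fps a = (293155 * fps_X ^ 2 + 888826 * fps_X - 29) / gf_denom"
    and "Abs_fps b = - ((237169 * fps_X ^ 2 + 550798 * fps_X + 1) / gf_denom)"
    and "Abs_fps c = (90601 * fps_X ^ 2 - 878594 * fps_X + 25) / gf_denom"
  shows "\<forall>n. a n \<in> \<int> \<and> b n \<in> \<int> \<and> c n \<in> \<int> \<and>
    a n ^ 3 + 2 * b n ^ 3 + 2 * c n ^ 3 = 6859"
proof
  fix n
  note steps = generating_function_steps[OF assms]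
  have orbit: "b n \<in> \<int> \<and> c n \<in> \<int> \<and>
      b n ^ 2 + 3 * b n * c n + c n ^ 2 - 38 * (b n + c n) + 361 = 0"
    using steps(2-5) by (rule unit_orbit_integral_on_conic)
  moreover have "a n \<in> \<int>"
    using orbit by (simp add: steps(1))
  moreover have "a n ^ 3 + 2 * b n ^ 3 + 2 * c n ^ 3 = 6859"
    using steps(1) orbit by (intro cubic_surface_contains_conic) simp_all
  ultimately show "a n \<in> \<int> \<and> b n \<in> \<int> \<and> c n \<in> \<int> \<and>
      a n ^ 3 + 2 * b n ^ 3 + 2 * c n ^ 3 = 6859"
    by blast
qed

end
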